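(* Let $f\colon\mathbb{R}^d\to\mathbb{R}$ be convex and differentiable with locally Lipschitz gradient $\nabla f$, and assume that the problem $\min_{x\in\mathbb{R}^d} f(x)$ has a solution. Let $x^0\in\mathbb{R}^d$, $t_0>0$, $\theta_0\ge 0$, $\delta\in(0,1)$, and let $\{\gamma_k\}_{k\ge1}$ be a sequence of real numbers with $\gamma_k\ge 0$ and $\sum_{k=1}^\infty\gamma_k<\infty$. Let $\{x^k\}$ be generated by $x^{k+1}=x^k-t_k\nabla f(x^k)$, $k\ge 0$, where for every $k\ge1$ the stepsize satisfies $t_k\in[l_k^{(1)},u_k^{(1)}]$ with $$l_k^{(1)}=\min\left\{\sqrt{1+\theta_{k-1}}\,t_{k-1},\ \frac{\delta}{\sqrt2 L_k}\right\},\qquad u_k^{(1)}=\min\left\{\sqrt{1+\theta_{k-1}}\,t_{k-1},\ \frac1{L_k}\sqrt{\frac12\left(1+\frac{\gamma_k}{\|x^k-x^{k-1}\|^2}\right)}\right\}.$$ Then the sequence $\{x^k\}$ is bounded, and every accumulation point of $\{x^k\}$ is an optimal solution of $\min_{x\in\mathbb{R}^d}f(x)$.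
   Context: $\|\cdot\|$ is the Euclidean norm. For $k\ge1$, $L_k=\dfrac{\|\nabla f(x^k)-\nabla f(x^{k-1})\|}{\|x^k-x^{k-1}\|}$ and $\theta_k=\dfrac{t_k}{t_{k-1}}$; $\theta_0$ is a given initial value. Conventions: the iteration does not terminate, i.e. $\nabla f(x^k)\ne0$ for all $k$ (so $x^k\neq x^{k-1}$ and $L_k$ is defined), and if $L_k=0$ then $c/L_k$ is read as $+\infty$ for $c>0$. *)

theory Defs
  imports "HOL-Analysis.Analysis"
begin

(* The library's local_lipschitz is about families of functions with an additional
   (time) parameter; this is the version without parameter, on the whole space. *)
definition locally_lipschitz :: "('a::metric_space \<Rightarrow> 'b::metric_space) \<Rightarrow> bool" where
  "locally_lipschitz g \<longleftrightarrow> (\<forall>y. \<exists>r>0. \<exists>C. C-lipschitz_on (cball y r) g)"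

abbreviation minimizer :: "('a \<Rightarrow> real) \<Rightarrow> 'a \<Rightarrow> bool" where
  "minimizer f \<equiv> is_arg_min f (\<lambda>_. True)"

definition accumulation_point :: "(nat \<Rightarrow> 'a::topological_space) \<Rightarrow> 'a \<Rightarrow> bool" where
  "accumulation_point x z \<longleftrightarrow> (\<exists>r. strict_mono r \<and> (x \<circ> r) \<longlonglongrightarrow> z)"

(* Only meaningful for k \<ge> 1 and x k \<noteq> x (k - 1); G is the gradient map. *)
definition local_curvature ::
  "('a::real_normed_vector \<Rightarrow> 'a) \<Rightarrow> (nat \<Rightarrow> 'a) \<Rightarrow> nat \<Rightarrow> real" where
  "local_curvature G x k = norm (G (x k) - G (x (k - 1))) / norm (x k - x (k - 1))"

definition step_ratio :: "real \<Rightarrow> (nat \<Rightarrow> real) \<Rightarrow> nat \<Rightarrow> real" where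
  "step_ratio \<theta>0 t k = (if k = 0 then \<theta>0 else t k / t (k - 1))"

(* The bounds are extended reals, because the second argument of the minimum is infinite if
   the local curvature is 0. This is what division does on ereal: c / 0 = \<infinity> for c > 0.
   Both bounds are only used for k \<ge> 1. *)
definition lower_step ::
  "('a::real_normed_vector \<Rightarrow> 'a) \<Rightarrow> real \<Rightarrow> real \<Rightarrow> (nat \<Rightarrow> 'a) \<Rightarrow> (nat \<Rightarrow> real) \<Rightarrow> nat \<Rightarrow> ereal" where
  "lower_step G \<delta> \<theta>0 x t k =
     min (ereal (sqrt (1 + step_ratio \<theta>0 t (k - 1)) * t (k - 1)))
         (ereal \<delta> / ereal (sqrt 2 * local_curvature G x k))"

definition upper_step ::
  "('a::real_normed_vector \<Rightarrow> 'a) \<Rightarrow> (nat \<Rightarrow> real) \<Rightarrow> real \<Rightarrow> (nat \<Rightarrow> 'a) \<Rightarrow> (nat \<Rightarrow> real) \<Rightarrow> nat \<Rightarrow> ereal" where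
  "upper_step G \<gamma> \<theta>0 x t k =
     min (ereal (sqrt (1 + step_ratio \<theta>0 t (k - 1)) * t (k - 1)))
         (ereal (sqrt (1 / 2 * (1 + \<gamma> k / (norm (x k - x (k - 1)))\<^sup>2)))
            / ereal (local_curvature G x k))"

lemma ereal_divide_zero_convention: "c > 0 \<Longrightarrow> ereal c / ereal 0 = \<infinity>"
  by (simp add: divide_ereal_def zero_ereal_def)

end

theory Submission
  imports Defs
begin

text \<open>
  Fix a minimizer \<open>z\<close> and write \<open>\<theta> k\<close> for the step ratio at \<open>k\<close>. The iteration need not decrease
  \<open>f\<close> or the distance to \<open>z\<close>, but up to the summable errors \<open>\<gamma>\<close> it decreases the energy
  \<open>(norm (x (Suc n) - z))\<^sup>2 + (norm (x (Suc n) - x n))\<^sup>2 + 2 * t n * (1 + \<theta> n) * (f (x n) - f z)\<close>.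
  The point is to control \<open>norm (x (Suc n) - x n)\<close> without a global Lipschitz constant.
  Since consecutive iterates differ by a multiple of the older gradient, convexity bounds the new
  squared gradient by the squared gradient difference plus a decrease of \<open>f\<close>
  (\<open>norm_gradient_step_sq_le\<close>). The curvature part of the upper stepsize bound absorbs the gradient
  difference into the previous step length, and the growth part
  \<open>t (Suc n) \<le> sqrt (1 + \<theta> n) * t n\<close> is exactly what makes the function values telescope
  (\<open>energy_descent_step\<close>). Hence the energy, and with it the sequence, is bounded.

  The same descent inequality leaves room for the term \<open>2 * t k * gap k\<close>, where
  \<open>gap k = f z - f (x k) - G (x k) \<bullet> (z - x k)\<close> is the error at \<open>z\<close> of the tangent at \<open>x k\<close>.
  These terms are therefore summable. All iterates lie in a ball around \<open>z\<close>, where \<open>G\<close> has some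
  Lipschitz constant \<open>L\<close>. This has two effects: the lower stepsize bound keeps \<open>t k\<close> above a
  positive constant (\<open>lower_step_ge\<close>), and \<open>gap k\<close> is at least \<open>(norm (G (x k)))\<^sup>2 / (4 * L)\<close>
  (\<open>squared_gradient_le_gap_at_minimizer\<close>). So the gradients tend to \<open>0\<close>; by continuity \<open>G\<close>
  vanishes at every accumulation point, which by convexity is then a minimizer.
\<close>

section \<open>Convex functions with locally Lipschitz gradient\<close>

text \<open>
  The one-dimensional tangent inequality along the line from \<open>y\<close> to \<open>z\<close>. It is the only form in
  which convexity enters the later lemmas.
\<close>

lemma convex_on_above_gradient_tangent:
  fixes f :: "'a::real_inner \<Rightarrow> real"
  assumes convex: "convex_on UNIV f" and gradient: "GDERIV f y :> g"
  shows "f y + g \<bullet> (z - y) \<le> f z"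
proof -
  define line where "line = (\<lambda>s::real. y + s *\<^sub>R (z - y))"
  have "convex_on UNIV (f \<circ> line)"
  proof (rule convex_onI)
    fix s a b :: real
    assume s: "0 < s" "s < 1"
    have "line ((1 - s) *\<^sub>R a + s *\<^sub>R b) = (1 - s) *\<^sub>R line a + s *\<^sub>R line b"
      by (simp add: line_def algebra_simps)
    then show "(f \<circ> line) ((1 - s) *\<^sub>R a + s *\<^sub>R b)
        \<le> (1 - s) * (f \<circ> line) a + s * (f \<circ> line) b"
      using convex_onD[OF convex, of s "line a" "line b"] s by simp
  qed simp
  moreover have "((f \<circ> line) has_field_derivative (g \<bullet> (z - y))) (at 0)"
  proof -
    have line: "(line has_derivative (\<lambda>s. s *\<^sub>R (z - y))) (at 0)"
      unfolding line_def by (auto intro!: derivative_eq_intros)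
    have "(f has_derivative (\<lambda>h. h \<bullet> g)) (at (line 0))"
      using gradient by (simp add: gderiv_def line_def)
    note diff_chain_at[OF line this]
    moreover have "(\<lambda>h. h \<bullet> g) \<circ> (\<lambda>s. s *\<^sub>R (z - y)) = (*) (g \<bullet> (z - y))"
      by (simp add: fun_eq_iff inner_commute mult.commute)
    ultimately show ?thesis
      by (simp only: has_field_derivative_def)
  qed
  ultimately have "(g \<bullet> (z - y)) * (1 - 0) \<le> (f \<circ> line) 1 - (f \<circ> line) 0"
    using convex_on_imp_above_tangent[of UNIV "f \<circ> line" 0 1] by simp
  then show ?thesis
    by (simp add: line_def)
qed

lemma gradient_at_minimizer:
  fixes f :: "'a::real_inner \<Rightarrow> real"
  assumes "minimizer f z" and "GDERIV f z :> g"
  shows "g = 0"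
proof -
  have "(\<lambda>h. h \<bullet> g) = (\<lambda>h. 0)"
    using assms by (intro has_derivative_local_min[of f _ z])
      (auto simp: is_arg_min_linorder gderiv_def intro!: eventuallyI)
  then have "g \<bullet> g = 0"
    by metis
  then show ?thesis
    by simp
qed

text \<open>
  The trivial parameter set \<open>{0}\<close> turns \<open>g\<close> into a constant family, for which the compactness
  argument is known.
\<close>

lemma locally_lipschitz_imp_lipschitz_on_compact:
  assumes "locally_lipschitz g" and "compact K"
  obtains L where "L-lipschitz_on K g"
proof -
  have "local_lipschitz {0::real} K (\<lambda>_. g)"
  proof (rule local_lipschitzI)
    fix s :: real and y
    obtain r C where "r > 0" "C-lipschitz_on (cball y r) g"
      using assms(1) unfolding locally_lipschitz_def by blast
    then show "\<exists>u>0. \<exists>L. \<forall>t \<in> cball s u \<inter> {0}. L-lipschitz_on (cball y u \<inter> K) g"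
      by (intro exI[of _ r] exI[of _ C] conjI ballI) (auto intro: lipschitz_on_subset)
  qed
  then show ?thesis
    using local_lipschitz_compact_implies_lipschitz[where X = K and T = "{0::real}" and f = "\<lambda>_. g"]
      \<open>compact K\<close> that
    by auto
qed

lemma locally_lipschitz_imp_isCont:
  assumes "locally_lipschitz g"
  shows "isCont g y"
proof -
  obtain r C where "r > 0" "C-lipschitz_on (cball y r) g"
    using assms unfolding locally_lipschitz_def by blast
  then show ?thesis
    by (meson centre_in_ball continuous_on_interior interior_cball
        lipschitz_on_continuous_on subsetD interior_maximal ball_subset_cball open_ball)
qed

text \<open>
  Compare \<open>f\<close> at \<open>w = z + G y / (2 * L)\<close> with two tangents. The tangent at \<open>y\<close> gains
  \<open>(norm (G y))\<^sup>2 / (2 * L)\<close> on the way from \<open>z\<close> to \<open>w\<close>, whereas \<open>f\<close> itself rises little there,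
  because \<open>G z = 0\<close> and so \<open>G w\<close> is small. The same constant also puts \<open>w\<close> into the ball that
  contains \<open>y\<close>, where \<open>G\<close> is Lipschitz.
\<close>

lemma squared_gradient_le_gap_at_minimizer:
  fixes f :: "'a::real_inner \<Rightarrow> real"
  assumes tangent: "\<And>u v. f u + G u \<bullet> (v - u) \<le> f v"
    and lipschitz: "L-lipschitz_on (cball z R) G" and "L > 0"
    and "G z = 0" and y: "y \<in> cball z R"
  shows "(norm (G y))\<^sup>2 / (4 * L) \<le> f z - f y - G y \<bullet> (z - y)"
proof -
  define w where "w = z + (1 / (2 * L)) *\<^sub>R G y"
  have "R \<ge> 0"
    using y zero_le_dist[of z y] by (simp del: zero_le_dist)
  have "norm (G y) \<le> L * dist y z"
    using lipschitz_onD[OF lipschitz y, of z] \<open>R \<ge> 0\<close> \<open>G z = 0\<close> by simp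
  also have "\<dots> \<le> L * R"
    using y \<open>L > 0\<close> by (simp add: dist_commute)
  also have "\<dots> \<le> 2 * L * R"
    using \<open>L > 0\<close> \<open>R \<ge> 0\<close> by simp
  finally have "w \<in> cball z R"
    using \<open>L > 0\<close> by (simp add: w_def dist_norm field_simps)
  then have Gw: "norm (G w) \<le> norm (G y) / 2"
    using lipschitz_onD[OF lipschitz, of w z] \<open>G z = 0\<close> \<open>R \<ge> 0\<close> \<open>L > 0\<close>
    by (simp add: w_def dist_norm)
  have "f y + G y \<bullet> (z - y) + (norm (G y))\<^sup>2 / (2 * L) = f y + G y \<bullet> (w - y)"
    by (simp add: w_def inner_diff_right inner_add_right power2_norm_eq_inner)
  also have "\<dots> \<le> f w"
    by (rule tangent)
  also have "\<dots> \<le> f z + (G w \<bullet> G y) / (2 * L)"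
    using tangent[of w z] by (simp add: w_def)
  also have "\<dots> \<le> f z + (norm (G y))\<^sup>2 / (4 * L)"
  proof -
    have "G w \<bullet> G y \<le> norm (G w) * norm (G y)"
      by (rule norm_cauchy_schwarz)
    also have "\<dots> \<le> (norm (G y))\<^sup>2 / 2"
      using mult_right_mono[OF Gw norm_ge_zero[of "G y"]] by (simp add: power2_eq_square)
    finally show ?thesis
      using \<open>L > 0\<close> by (simp add: field_simps)
  qed
  finally show ?thesis
    by (simp add: field_simps)
qed

section \<open>Energy descent\<close>

text \<open>
  Expand \<open>(norm (G y - G w))\<^sup>2\<close> and use the product \<open>G w \<bullet> G y\<close> twice: as \<open>y - w\<close> is a multiple of
  \<open>G w\<close>, monotonicity of \<open>G\<close> gives \<open>G w \<bullet> G y \<le> G w \<bullet> G w\<close>, and the tangent at \<open>y\<close> gives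
  \<open>s * (G w \<bullet> G y) \<le> f w - f y\<close>. Monotonicity cancels one copy of the product. Without it, the
  decrease of \<open>f\<close> would appear with the factor 2, and steps could only be allowed to grow more slowly.
\<close>

lemma norm_gradient_step_sq_le:
  fixes f :: "'a::real_inner \<Rightarrow> real"
  assumes tangent: "\<And>u v. f u + G u \<bullet> (v - u) \<le> f v"
    and y: "y = w - s *\<^sub>R G w" and "s > 0"
  shows "(norm (G y))\<^sup>2 \<le> (norm (G y - G w))\<^sup>2 + (f w - f y) / s"
proof -
  have "0 \<le> s * (G w \<bullet> (G w - G y))"
    using tangent[of w y] tangent[of y w] by (simp add: y algebra_simps inner_commute)
  then have monotone: "G w \<bullet> G y \<le> G w \<bullet> G w"
    using \<open>s > 0\<close> by (simp add: zero_le_mult_iff inner_diff_right)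
  have "s * (G w \<bullet> G y) \<le> f w - f y"
    using tangent[of y w] by (simp add: y inner_commute)
  then have "G w \<bullet> G y \<le> (f w - f y) / s"
    using \<open>s > 0\<close> by (simp add: field_simps)
  moreover have "(norm (G y))\<^sup>2 \<le> (norm (G y - G w))\<^sup>2 + G w \<bullet> G y"
    using monotone
    by (simp add: power2_norm_eq_inner inner_diff_left inner_diff_right inner_commute)
  ultimately show ?thesis
    by simp
qed

text \<open>
  Here \<open>w\<close>, \<open>y\<close>, \<open>y'\<close> are consecutive iterates with steps \<open>s\<close>, \<open>s'\<close>, and \<open>\<theta>\<close> is the step ratio
  that belongs to \<open>s\<close>. Expanding \<open>y' - z\<close> produces \<open>(norm (y' - y))\<^sup>2\<close> once; a second copy is added
  to both sides, so that the curvature bound, which carries a factor 2, returns exactly one copy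
  of \<open>(norm (y - w))\<^sup>2\<close>. The decrease of \<open>f\<close> gets the weight \<open>s'\<^sup>2 / s\<close>, which the growth bound
  keeps below the weight \<open>s * (1 + \<theta>)\<close> available from the preceding step.
\<close>

lemma energy_descent_step:
  fixes f :: "'a::real_inner \<Rightarrow> real"
  assumes tangent: "\<And>u v. f u + G u \<bullet> (v - u) \<le> f v"
    and minimal: "\<And>v. f z \<le> f v"
    and y: "y = w - s *\<^sub>R G w" and y': "y' = y - s' *\<^sub>R G y"
    and "s > 0" and "s' > 0" and "\<theta> \<ge> 0"
    and growth: "s' \<le> sqrt (1 + \<theta>) * s"
    and curvature: "2 * (s' * norm (G y - G w))\<^sup>2 \<le> (norm (y - w))\<^sup>2 + \<gamma>"
  shows "(norm (y' - z))\<^sup>2 + (norm (y' - y))\<^sup>2 + 2 * (s' * (1 + s' / s)) * (f y - f z)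
      + 2 * s' * (f z - f y - G y \<bullet> (z - y))
    \<le> (norm (y - z))\<^sup>2 + (norm (y - w))\<^sup>2 + 2 * (s * (1 + \<theta>)) * (f w - f z) + \<gamma>"
proof -
  have expand: "(norm (y' - z))\<^sup>2
      = (norm (y - z))\<^sup>2 + 2 * s' * (G y \<bullet> (z - y)) + (norm (y' - y))\<^sup>2"
  proof -
    have "2 * ((y - z) \<bullet> (y' - y)) = 2 * s' * (G y \<bullet> (z - y))"
      by (simp add: y' inner_diff_left inner_diff_right inner_commute algebra_simps)
    then show ?thesis
      using dot_norm[of "y - z" "y' - y"] by simp
  qed
  have "2 * (norm (y' - y))\<^sup>2 = 2 * s'\<^sup>2 * (norm (G y))\<^sup>2"
    by (simp add: y' power_mult_distrib)
  also have "\<dots> \<le> 2 * s'\<^sup>2 * ((norm (G y - G w))\<^sup>2 + (f w - f y) / s)"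
    by (intro mult_left_mono norm_gradient_step_sq_le[OF tangent y \<open>s > 0\<close>]) simp
  also have "\<dots> = 2 * (s' * norm (G y - G w))\<^sup>2 + 2 * (s'\<^sup>2 / s) * (f w - f y)"
    by (simp add: algebra_simps power_mult_distrib)
  also have "\<dots> \<le> (norm (y - w))\<^sup>2 + \<gamma> + 2 * (s'\<^sup>2 / s) * (f w - f y)"
    using curvature by simp
  also have "2 * (s'\<^sup>2 / s) * (f w - f y)
      = 2 * (s'\<^sup>2 / s) * (f w - f z) - 2 * (s'\<^sup>2 / s) * (f y - f z)"
    by (simp only: right_diff_distrib)
  finally have step: "2 * (norm (y' - y))\<^sup>2 + 2 * (s'\<^sup>2 / s) * (f y - f z)
      \<le> (norm (y - w))\<^sup>2 + \<gamma> + 2 * (s'\<^sup>2 / s) * (f w - f z)"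
    by linarith
  have "s'\<^sup>2 \<le> (sqrt (1 + \<theta>) * s)\<^sup>2"
    using growth \<open>s' > 0\<close> by (intro power_mono) auto
  also have "\<dots> = (1 + \<theta>) * s\<^sup>2"
    using \<open>\<theta> \<ge> 0\<close> by (simp add: power_mult_distrib)
  finally have "s'\<^sup>2 / s \<le> s * (1 + \<theta>)"
    using \<open>s > 0\<close> by (simp add: field_simps power2_eq_square)
  then have "2 * (s'\<^sup>2 / s) * (f w - f z) \<le> 2 * (s * (1 + \<theta>)) * (f w - f z)"
    using minimal[of w] by (intro mult_right_mono) auto
  moreover have "2 * (s' * (1 + s' / s)) * (f y - f z)
      = 2 * s' * (f y - f z) + 2 * (s'\<^sup>2 / s) * (f y - f z)"
    by (simp add: algebra_simps power2_eq_square)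
  moreover have "2 * s' * (f z - f y - G y \<bullet> (z - y))
      = - 2 * s' * (f y - f z) - 2 * s' * (G y \<bullet> (z - y))"
    by (simp add: algebra_simps)
  ultimately show ?thesis
    using expand step by linarith
qed

text \<open>Telescoping: the terms \<open>a\<close> are paid for by the initial energy and all of the errors.\<close>

lemma perturbed_descent:
  fixes E a c :: "nat \<Rightarrow> real"
  assumes descent: "\<And>n. E (Suc n) + a n \<le> E n + c n"
    and "\<And>n. E n \<ge> 0" and "\<And>n. a n \<ge> 0" and "\<And>n. c n \<ge> 0" and "summable c"
  shows "E n \<le> E 0 + suminf c" and "summable a"
proof -
  have telescope: "E n + (\<Sum>i<n. a i) \<le> E 0 + (\<Sum>i<n. c i)" for n
  proof (induction n)
    case (Suc n)
    then show ?case
      using descent[of n] by simp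
  qed simp
  have partial: "(\<Sum>i<n. c i) \<le> suminf c" for n
    using assms by (intro sum_le_suminf) auto
  show "E n \<le> E 0 + suminf c"
    using telescope[of n] partial[of n] sum_nonneg[of "{..<n}" a] assms(3) by fastforce
  show "summable a"
  proof (rule summableI_nonneg_bounded)
    show "(\<Sum>i<n. a i) \<le> E 0 + suminf c" for n
      using telescope[of n] partial[of n] assms(2)[of n] by linarith
  qed (rule assms)
qed

section \<open>The stepsize window\<close>

text \<open>
  Multiplying by the curvature gives a real inequality that also covers curvature 0, where the
  extended-real bound is infinite: its left-hand side is then 0.
\<close>

lemma upper_step_curvature_bound:
  assumes le: "ereal (t (Suc n)) \<le> upper_step G \<gamma> \<theta>0 x t (Suc n)"
    and "t (Suc n) \<ge> 0" and "\<gamma> (Suc n) \<ge> 0" and neq: "x (Suc n) \<noteq> x n"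
  shows "2 * (t (Suc n) * norm (G (x (Suc n)) - G (x n)))\<^sup>2
    \<le> (norm (x (Suc n) - x n))\<^sup>2 + \<gamma> (Suc n)"
proof (cases "G (x (Suc n)) = G (x n)")
  case True
  then show ?thesis
    using assms by simp
next
  case False
  define d where "d = norm (x (Suc n) - x n)"
  define e where "e = norm (G (x (Suc n)) - G (x n))"
  define q where "q = 1 / 2 * (1 + \<gamma> (Suc n) / d\<^sup>2)"
  have "d > 0" "e > 0" "q \<ge> 0"
    using neq False assms by (auto simp: d_def e_def q_def)
  have "local_curvature G x (Suc n) = e / d"
    by (simp add: local_curvature_def d_def e_def)
  then have "t (Suc n) \<le> sqrt q / (e / d)"
    using le \<open>d > 0\<close> \<open>e > 0\<close> by (simp add: upper_step_def q_def d_def)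
  then have "t (Suc n) * e \<le> sqrt q * d"
    using \<open>d > 0\<close> \<open>e > 0\<close> by (simp add: field_simps)
  then have "(t (Suc n) * e)\<^sup>2 \<le> (sqrt q * d)\<^sup>2"
    using \<open>t (Suc n) \<ge> 0\<close> \<open>e > 0\<close> by (intro power_mono) auto
  also have "\<dots> = q * d\<^sup>2"
    using \<open>q \<ge> 0\<close> by (simp add: power_mult_distrib)
  also have "\<dots> = (d\<^sup>2 + \<gamma> (Suc n)) / 2"
    using \<open>d > 0\<close> by (simp add: q_def field_simps)
  finally show ?thesis
    by (simp add: d_def e_def)
qed

text \<open>
  The step can fall below its predecessor only by hitting the curvature bound, and this is bounded
  away from 0 as long as the curvature is bounded.
\<close>

lemma lower_step_ge:
  assumes ge: "lower_step G \<delta> \<theta>0 x t (Suc n) \<le> ereal (t (Suc n))"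
    and "step_ratio \<theta>0 t n \<ge> 0" and "t n \<ge> 0" and "\<delta> > 0" and "L > 0"
    and "norm (G (x (Suc n)) - G (x n)) \<le> L * norm (x (Suc n) - x n)"
  shows "min (t n) (\<delta> / (sqrt 2 * L)) \<le> t (Suc n)"
proof -
  define c where "c = local_curvature G x (Suc n)"
  have "c \<ge> 0" "c \<le> L"
    using assms by (auto simp: c_def local_curvature_def divide_le_eq)
  have "sqrt 1 * t n \<le> sqrt (1 + step_ratio \<theta>0 t n) * t n"
    using assms by (intro mult_right_mono real_sqrt_le_mono) auto
  then have "ereal (t n) \<le> ereal (sqrt (1 + step_ratio \<theta>0 t n) * t n)"
    by simp
  moreover have "ereal (\<delta> / (sqrt 2 * L)) \<le> ereal \<delta> / ereal (sqrt 2 * c)"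
  proof (cases "c = 0")
    case True
    then show ?thesis
      using ereal_divide_zero_convention[OF \<open>\<delta> > 0\<close>] by simp
  next
    case False
    then have "\<delta> / (sqrt 2 * L) \<le> \<delta> / (sqrt 2 * c)"
      using assms \<open>c \<ge> 0\<close> \<open>c \<le> L\<close> by (intro divide_left_mono) auto
    then show ?thesis
      using False by simp
  qed
  ultimately have "min (ereal (t n)) (ereal (\<delta> / (sqrt 2 * L))) \<le> lower_step G \<delta> \<theta>0 x t (Suc n)"
    unfolding lower_step_def c_def by (intro min.mono) auto
  then show ?thesis
    using ge by (metis dual_order.trans ereal_less_eq(3) ereal_min)
qed

section \<open>Boundedness and optimality of accumulation points\<close>

theorem theorem3:
  fixes f :: "real ^ 'd \<Rightarrow> real"
    and G :: "real ^ 'd \<Rightarrow> real ^ 'd"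
    and x :: "nat \<Rightarrow> real ^ 'd"
    and t \<gamma> :: "nat \<Rightarrow> real"
    and \<theta>0 \<delta> :: real
  assumes convex: "convex_on UNIV f"
    and gradient: "\<And>y. GDERIV f y :> G y"
    and lipschitz: "locally_lipschitz G"
    and solution: "\<exists>z. minimizer f z"
    and t0: "t 0 > 0"
    and theta0: "\<theta>0 \<ge> 0"
    and delta: "0 < \<delta>" "\<delta> < 1"
    and gamma_nonneg: "\<And>k. k \<ge> 1 \<Longrightarrow> \<gamma> k \<ge> 0"
    and gamma_summable: "summable (\<lambda>k. \<gamma> (Suc k))"
    and iteration: "\<And>k. x (Suc k) = x k - t k *\<^sub>R G (x k)"
    and nonterminating: "\<And>k. G (x k) \<noteq> 0"
    and stepsize: "\<And>k. k \<ge> 1 \<Longrightarrow>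
          ereal (t k) \<in> {lower_step G \<delta> \<theta>0 x t k .. upper_step G \<gamma> \<theta>0 x t k}"
  shows "bounded (range x) \<and> (\<forall>z. accumulation_point x z \<longrightarrow> minimizer f z)"
proof -
  obtain z where z: "minimizer f z"
    using solution by blast
  have minimal: "f z \<le> f v" for v
    using z by (simp add: is_arg_min_linorder)
  have "G z = 0"
    using gradient_at_minimizer[OF z gradient] .
  have tangent: "f u + G u \<bullet> (v - u) \<le> f v" for u v
    using convex_on_above_gradient_tangent[OF convex gradient] .

  \<comment> \<open>No bound on the curvatures is known yet; each single curvature, plus 1 to make it positive,
    serves as Lipschitz constant for its own step.\<close>
  have positive: "t n > 0 \<and> step_ratio \<theta>0 t n \<ge> 0" for n
  proof (induction n)
    case 0
    then show ?case
      using t0 theta0 by (simp add: step_ratio_def)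
  next
    case (Suc n)
    define c where "c = local_curvature G x (Suc n)"
    have "min (t n) (\<delta> / (sqrt 2 * (c + 1))) \<le> t (Suc n)"
    proof (rule lower_step_ge)
      have "c \<ge> 0"
        by (simp add: c_def local_curvature_def)
      then show "c + 1 > 0"
        by simp
      have "x (Suc n) \<noteq> x n"
        using iteration[of n] nonterminating[of n] Suc by simp
      then show "norm (G (x (Suc n)) - G (x n)) \<le> (c + 1) * norm (x (Suc n) - x n)"
        by (simp add: c_def local_curvature_def field_simps)
    qed (use stepsize[of "Suc n"] Suc delta in auto)
    moreover have "c + 1 > 0"
      by (simp add: c_def local_curvature_def add_nonneg_pos)
    ultimately have "t (Suc n) > 0"
      using Suc delta by (smt (verit) divide_pos_pos mult_pos_pos real_sqrt_gt_zero)
    then show ?case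
      using Suc by (simp add: step_ratio_def)
  qed
  have distinct: "x (Suc n) \<noteq> x n" for n
    using iteration[of n] nonterminating[of n] positive[of n] by simp

  define gap where "gap n = f z - f (x n) - G (x n) \<bullet> (z - x n)" for n
  define E where "E n = (norm (x (Suc n) - z))\<^sup>2 + (norm (x (Suc n) - x n))\<^sup>2
      + 2 * (t n * (1 + step_ratio \<theta>0 t n)) * (f (x n) - f z)" for n
  have gap_nonneg: "gap n \<ge> 0" for n
    using tangent[of "x n" z] by (simp add: gap_def)
  have descent: "E (Suc n) + 2 * t (Suc n) * gap (Suc n) \<le> E n + \<gamma> (Suc n)" for n
  proof -
    have growth: "t (Suc n) \<le> sqrt (1 + step_ratio \<theta>0 t n) * t n"
      using stepsize[of "Suc n"] by (simp add: upper_step_def)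
    have "2 * (t (Suc n) * norm (G (x (Suc n)) - G (x n)))\<^sup>2
        \<le> (norm (x (Suc n) - x n))\<^sup>2 + \<gamma> (Suc n)"
      using stepsize[of "Suc n"] positive[of "Suc n"] gamma_nonneg[of "Suc n"] distinct[of n]
      by (intro upper_step_curvature_bound) auto
    from energy_descent_step[of f G, OF tangent minimal iteration iteration _ _ _ growth this]
    show ?thesis
      using positive[of n] positive[of "Suc n"] by (simp add: E_def gap_def step_ratio_def)
  qed
  have part_nonneg: "2 * (t n * (1 + step_ratio \<theta>0 t n)) * (f (x n) - f z) \<ge> 0" for n
    using positive[of n] minimal[of "x n"] by simp
  have E_nonneg: "E n \<ge> 0" for n
    using part_nonneg[of n] by (simp add: E_def)
  note energy = perturbed_descent[where E = E and c = "\<lambda>n. \<gamma> (Suc n)", OF descent E_nonneg]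
  have energy_bound: "E n \<le> E 0 + (\<Sum>n. \<gamma> (Suc n))" for n
    using positive gap_nonneg gamma_nonneg gamma_summable by (intro energy) (auto simp: less_imp_le)
  have gap_summable: "summable (\<lambda>n. 2 * t (Suc n) * gap (Suc n))"
    using positive gap_nonneg gamma_nonneg gamma_summable by (intro energy) (auto simp: less_imp_le)

  obtain R where R: "x n \<in> cball z R" for n
  proof -
    define B where "B = sqrt (E 0 + (\<Sum>n. \<gamma> (Suc n)))"
    have "x n \<in> cball z (max B (dist z (x 0)))" for n
    proof (cases n)
      case (Suc m)
      have "(norm (x (Suc m) - z))\<^sup>2 \<le> E m"
        using part_nonneg[of m] by (simp add: E_def)
      then have "norm (x (Suc m) - z) \<le> B"
        unfolding B_def using energy_bound[of m] by (intro real_le_rsqrt) simp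
      then show ?thesis
        by (simp add: Suc dist_norm norm_minus_commute)
    qed simp
    then show thesis
      by (rule that)
  qed

  obtain L where L: "L-lipschitz_on (cball z R) G" and "L > 0"
  proof -
    obtain L0 where L0: "L0-lipschitz_on (cball z R) G"
      using locally_lipschitz_imp_lipschitz_on_compact[OF lipschitz compact_cball] .
    show thesis
    proof
      show "(max L0 1)-lipschitz_on (cball z R) G"
        by (rule lipschitz_on_mono[OF L0]) auto
    qed simp
  qed

  define \<tau> where "\<tau> = min (t 0) (\<delta> / (sqrt 2 * L))"
  have "\<tau> > 0"
    using t0 delta \<open>L > 0\<close> by (simp add: \<tau>_def)
  have step_ge: "\<tau> \<le> t n" for n
  proof (induction n)
    case (Suc n)
    have "min (t n) (\<delta> / (sqrt 2 * L)) \<le> t (Suc n)"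
    proof (rule lower_step_ge)
      show "norm (G (x (Suc n)) - G (x n)) \<le> L * norm (x (Suc n) - x n)"
        using lipschitz_onD[OF L R R] by (simp add: dist_norm)
    qed (use stepsize[of "Suc n"] positive[of n] delta \<open>L > 0\<close> in auto)
    then show ?case
      using Suc by (simp add: \<tau>_def)
  qed (simp add: \<tau>_def)

  have gradient_vanishes: "(\<lambda>n. G (x n)) \<longlonglongrightarrow> 0"
  proof -
    have "(\<lambda>n. (2 * L / \<tau>) * (2 * t (Suc n) * gap (Suc n))) \<longlonglongrightarrow> (2 * L / \<tau>) * 0"
      by (intro tendsto_intros summable_LIMSEQ_zero[OF gap_summable])
    then have majorant: "(\<lambda>n. (2 * L / \<tau>) * (2 * t (Suc n) * gap (Suc n))) \<longlonglongrightarrow> 0"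
      by simp
    have "(norm (G (x (Suc n))))\<^sup>2 \<le> (2 * L / \<tau>) * (2 * t (Suc n) * gap (Suc n))" for n
    proof -
      have "(norm (G (x (Suc n))))\<^sup>2 \<le> 4 * L * gap (Suc n)"
        using squared_gradient_le_gap_at_minimizer[OF tangent L \<open>L > 0\<close> \<open>G z = 0\<close> R, of "Suc n"]
          \<open>L > 0\<close> by (simp add: gap_def field_simps)
      also have "\<dots> = (2 * L / \<tau>) * (2 * \<tau> * gap (Suc n))"
        using \<open>\<tau> > 0\<close> by simp
      also have "\<dots> \<le> (2 * L / \<tau>) * (2 * t (Suc n) * gap (Suc n))"
        using step_ge[of "Suc n"] gap_nonneg[of "Suc n"] \<open>L > 0\<close> \<open>\<tau> > 0\<close>
        by (intro mult_left_mono mult_right_mono) auto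
      finally show ?thesis .
    qed
    then have "(\<lambda>n. (norm (G (x (Suc n))))\<^sup>2) \<longlonglongrightarrow> 0"
      by (intro tendsto_sandwich[OF _ _ tendsto_const majorant]) (auto intro!: always_eventually)
    then have "(\<lambda>n. sqrt ((norm (G (x (Suc n))))\<^sup>2)) \<longlonglongrightarrow> sqrt 0"
      by (rule tendsto_real_sqrt)
    then have "(\<lambda>n. G (x (Suc n))) \<longlonglongrightarrow> 0"
      by (simp add: tendsto_norm_zero_iff)
    then show ?thesis
      by (rule LIMSEQ_imp_Suc)
  qed

  show ?thesis
  proof (intro conjI allI impI)
    show "bounded (range x)"
      using R by (intro bounded_subset[OF bounded_cball[of z R]]) auto
  next
    fix p
    assume "accumulation_point x p"
    then obtain r where r: "strict_mono r" "(x \<circ> r) \<longlonglongrightarrow> p"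
      by (auto simp: accumulation_point_def)
    have "(\<lambda>n. G ((x \<circ> r) n)) \<longlonglongrightarrow> G p"
      using isCont_tendsto_compose[OF locally_lipschitz_imp_isCont[OF lipschitz] r(2)] .
    moreover have "(\<lambda>n. G ((x \<circ> r) n)) \<longlonglongrightarrow> 0"
      using LIMSEQ_subseq_LIMSEQ[OF gradient_vanishes r(1)] by (simp add: o_def)
    ultimately have "G p = 0"
      by (rule LIMSEQ_unique)
    then show "minimizer f p"
      using tangent[of p] by (simp add: is_arg_min_linorder)
  qed
qed

end
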